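(* Let $(u,v)$ be a nonnegative classical solution of the Dirichlet problem $$\begin{cases}\Delta[(d_1+a_{11}u)u]+u(1-u-a_1v)=0, & x\in\Omega,\\ \Delta[(d_2+a_{22}v)v]+v(1-a_2u-v)=0, & x\in\Omega,\\ u=v=0, & x\in\partial\Omega.\end{cases}$$ Suppose that either (i) $a_1>1>a_2$, $d_1>d_2$ and $d_1\ge d_2+2a_{22}$, or (ii) $a_1<1<a_2$, $d_1<d_2$ and $d_2\ge d_1+2a_{11}$. Then the system has no coexisting solutions, that is, $u\equiv0$ or $v\equiv0$ in $\Omega$.
   Context: $\Omega\subset\mathbb{R}^n$ ($n\ge1$) is a bounded domain with smooth boundary satisfying the interior ball condition at every boundary point. The constants satisfy $a_1,a_2,d_1,d_2>0$ and $a_{11},a_{22}\ge0$. A nonnegative classical solution is a pair $(u,v)\in (C^1(\overline\Omega)\cap C^2(\Omega))^2$ with $u,v\ge0$ in $\overline\Omega$ satisfying the system (equations and boundary conditions) pointwise. A coexisting solution is a nonnegative classical solution with $u\not\equiv0$ and $v\not\equiv0$. *)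

theory Defs
  imports "HOL-Analysis.Analysis"
begin

definition partial_deriv :: "'n::finite \<Rightarrow> (real^'n \<Rightarrow> real) \<Rightarrow> real^'n \<Rightarrow> real" where
  "partial_deriv i f x = frechet_derivative f (at x) (axis i 1)"

definition laplacian :: "(real^'n::finite \<Rightarrow> real) \<Rightarrow> real^'n \<Rightarrow> real" where
  "laplacian f x = (\<Sum>i\<in>UNIV. partial_deriv i (partial_deriv i f) x)"

text \<open>The class $C^k(S)$, meant for open \<open>S\<close>.\<close>

fun Ck_on :: "nat \<Rightarrow> (real^'n::finite \<Rightarrow> real) \<Rightarrow> (real^'n) set \<Rightarrow> bool" where
  "Ck_on 0 f S \<longleftrightarrow> continuous_on S f"
| "Ck_on (Suc k) f S \<longleftrightarrow>
     (\<forall>x\<in>S. f differentiable (at x)) \<and> (\<forall>i. Ck_on k (partial_deriv i f) S)"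

definition smooth_on :: "(real^'n::finite \<Rightarrow> real) \<Rightarrow> (real^'n) set \<Rightarrow> bool" where
  "smooth_on f S \<longleftrightarrow> (\<forall>k. Ck_on k f S)"

text \<open>$C^1(\overline\Omega)$: the function is continuous up to the boundary, and each of its first
  partial derivatives in $\Omega$ has a continuous extension to $\overline\Omega$.\<close>

definition C1_closure :: "(real^'n::finite \<Rightarrow> real) \<Rightarrow> (real^'n) set \<Rightarrow> bool" where
  "C1_closure f \<Omega> \<longleftrightarrow>
     continuous_on (closure \<Omega>) f \<and> Ck_on 1 f \<Omega> \<and>
     (\<forall>i. \<exists>g. continuous_on (closure \<Omega>) g \<and> (\<forall>x\<in>\<Omega>. g x = partial_deriv i f x))"

text \<open>Near each boundary point, after an orthogonal change of coordinates \<open>T\<close>, the set is the region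
  above the graph of a smooth function of the remaining \<open>n - 1\<close> coordinates. Such a function is
  represented by a smooth \<open>\<gamma>\<close> on the whole space that does not depend on the coordinate \<open>k\<close>;
  for \<open>n = 1\<close> it is a constant.\<close>

definition smooth_boundary :: "(real^'n::finite) set \<Rightarrow> bool" where
  "smooth_boundary \<Omega> \<longleftrightarrow>
     (\<forall>p\<in>frontier \<Omega>. \<exists>r>0. \<exists>(T :: real^'n \<Rightarrow> real^'n) k \<gamma>.
        orthogonal_transformation T \<and> smooth_on \<gamma> UNIV \<and>
        (\<forall>y s. \<gamma> (y + s *\<^sub>R axis k 1) = \<gamma> y) \<and>
        \<Omega> \<inter> ball p r = {x \<in> ball p r. \<gamma> (T x) < T x $ k})"

definition interior_ball_condition :: "(real^'n::finite) set \<Rightarrow> bool" where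
  "interior_ball_condition \<Omega> \<longleftrightarrow>
     (\<forall>p\<in>frontier \<Omega>. \<exists>y r. 0 < r \<and> ball y r \<subseteq> \<Omega> \<and> p \<in> sphere y r)"

definition nonneg_classical_solution ::
  "(real^'n::finite) set \<Rightarrow> real \<Rightarrow> real \<Rightarrow> real \<Rightarrow> real \<Rightarrow> real \<Rightarrow> real
     \<Rightarrow> (real^'n \<Rightarrow> real) \<Rightarrow> (real^'n \<Rightarrow> real) \<Rightarrow> bool" where
  "nonneg_classical_solution \<Omega> d\<^sub>1 d\<^sub>2 a\<^sub>1 a\<^sub>2 a\<^sub>1\<^sub>1 a\<^sub>2\<^sub>2 u v \<longleftrightarrow>
     C1_closure u \<Omega> \<and> Ck_on 2 u \<Omega> \<and> C1_closure v \<Omega> \<and> Ck_on 2 v \<Omega> \<and>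
     (\<forall>x\<in>closure \<Omega>. 0 \<le> u x \<and> 0 \<le> v x) \<and>
     (\<forall>x\<in>\<Omega>. laplacian (\<lambda>y. (d\<^sub>1 + a\<^sub>1\<^sub>1 * u y) * u y) x + u x * (1 - u x - a\<^sub>1 * v x) = 0) \<and>
     (\<forall>x\<in>\<Omega>. laplacian (\<lambda>y. (d\<^sub>2 + a\<^sub>2\<^sub>2 * v y) * v y) x + v x * (1 - a\<^sub>2 * u x - v x) = 0) \<and>
     (\<forall>x\<in>frontier \<Omega>. u x = 0 \<and> v x = 0)"

definition coexisting_solution ::
  "(real^'n::finite) set \<Rightarrow> real \<Rightarrow> real \<Rightarrow> real \<Rightarrow> real \<Rightarrow> real \<Rightarrow> real
     \<Rightarrow> (real^'n \<Rightarrow> real) \<Rightarrow> (real^'n \<Rightarrow> real) \<Rightarrow> bool" where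
  "coexisting_solution \<Omega> d\<^sub>1 d\<^sub>2 a\<^sub>1 a\<^sub>2 a\<^sub>1\<^sub>1 a\<^sub>2\<^sub>2 u v \<longleftrightarrow>
     nonneg_classical_solution \<Omega> d\<^sub>1 d\<^sub>2 a\<^sub>1 a\<^sub>2 a\<^sub>1\<^sub>1 a\<^sub>2\<^sub>2 u v \<and>
     (\<exists>x\<in>\<Omega>. u x \<noteq> 0) \<and> (\<exists>x\<in>\<Omega>. v x \<noteq> 0)"

end

theory Submission imports Defs begin

text \<open>By symmetry let \<open>d\<^sub>1 > d\<^sub>2\<close>. Put \<open>P = (d\<^sub>1 + a\<^sub>1\<^sub>1 u) u\<close>, \<open>Q = (d\<^sub>2 + a\<^sub>2\<^sub>2 v) v\<close> and look at a maximum point of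
  \<open>h = d\<^sub>1 ln u + 2 a\<^sub>1\<^sub>1 u - d\<^sub>2 ln v - 2 a\<^sub>2\<^sub>2 v\<close>, chosen such that \<open>\<nabla>h = \<nabla>P/u - \<nabla>Q/v\<close>. At a critical
  point both quotients equal some \<open>A\<close>, and
  \<open>\<Delta>h = \<Delta>P/u - \<Delta>Q/v + \<bar>A\<bar>\<^sup>2 (1/(d\<^sub>2 + 2 a\<^sub>2\<^sub>2 v) - 1/(d\<^sub>1 + 2 a\<^sub>1\<^sub>1 u))\<close>. The bracket is nonnegative because
  \<open>v \<le> 1\<close> and \<open>d\<^sub>1 \<ge> d\<^sub>2 + 2 a\<^sub>2\<^sub>2\<close>, so an interior maximum gives
  \<open>0 \<ge> \<Delta>P/u - \<Delta>Q/v = (1 - a\<^sub>2) u + (a\<^sub>1 - 1) v > 0\<close>. The maximum is interior: the strong maximum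
  principle and Hopf's lemma for \<open>Q\<close> give \<open>u \<le> K v\<close> near each boundary point, and then
  \<open>exp h\<close> is at most a constant times \<open>v powr (d\<^sub>1 - d\<^sub>2)\<close>, which tends to \<open>0\<close>.\<close>

subsection \<open>Second derivatives along coordinate lines\<close>

text \<open>If \<open>g''\<close> were positive, \<open>g'\<close> would be positive just to the
  right of its zero at \<open>0\<close>, and the mean value theorem would produce a larger value of
  \<open>g\<close> there.\<close>

lemma second_derivative_test_max:
  fixes g :: "real \<Rightarrow> real"
  assumes "0 < \<eta>"
    and g: "\<And>t. \<bar>t\<bar> < \<eta> \<Longrightarrow> (g has_real_derivative g' t) (at t)"
    and g': "(g' has_real_derivative g'') (at 0)"
    and max: "\<And>t. \<bar>t\<bar> < \<eta> \<Longrightarrow> g t \<le> g 0"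
  shows "g' 0 = 0" and "g'' \<le> 0"
proof -
  show g'0: "g' 0 = 0"
    using DERIV_local_max[of g "g' 0" 0 \<eta>] g[of 0] max \<open>0 < \<eta>\<close> by auto
  show "g'' \<le> 0"
  proof (rule ccontr)
    assume "\<not> g'' \<le> 0"
    then obtain d where d: "0 < d" "\<And>h. 0 < h \<Longrightarrow> h < d \<Longrightarrow> g' 0 < g' (0 + h)"
      using DERIV_pos_inc_right[OF g'] by force
    define s where "s = min d \<eta> / 2"
    have s: "0 < s" "s < d" "s < \<eta>"
      using d(1) \<open>0 < \<eta>\<close> by (auto simp: s_def min_def)
    obtain z where z: "0 < z" "z < s" "g s - g 0 = (s - 0) * g' z"
      using MVT2[of 0 s g g'] g s by force
    have "0 < g' z"
      using d(2)[of z] z s g'0 by auto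
    then have "g 0 < g s"
      using z s by (smt (verit) mult_pos_pos)
    then show False
      using max[of s] s by auto
  qed
qed

lemma has_real_derivative_line:
  fixes f :: "'a::real_normed_vector \<Rightarrow> real"
  assumes "f differentiable (at (x + t *\<^sub>R e))"
  shows "((\<lambda>t. f (x + t *\<^sub>R e)) has_real_derivative
           frechet_derivative f (at (x + t *\<^sub>R e)) e) (at t)"
proof -
  let ?D = "frechet_derivative f (at (x + t *\<^sub>R e))"
  have D: "(f has_derivative ?D) (at (x + t *\<^sub>R e))"
    using assms by (rule frechet_derivative_works[THEN iffD1])
  have "((\<lambda>t. x + t *\<^sub>R e) has_derivative (\<lambda>s. s *\<^sub>R e)) (at t)"
    by (auto intro!: derivative_eq_intros)
  from diff_chain_at[OF this D] have "((\<lambda>t. f (x + t *\<^sub>R e)) has_derivative (\<lambda>s. ?D (s *\<^sub>R e))) (at t)"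
    by (simp add: o_def)
  moreover have "(\<lambda>s. ?D (s *\<^sub>R e)) = (*) (?D e)"
    using has_derivative_linear[OF D] by (auto simp: linear_cmul mult.commute)
  ultimately show ?thesis
    by (simp add: has_field_derivative_def)
qed

lemma open_line_nhd:
  fixes S :: "'a::real_normed_vector set"
  assumes "open S" "x \<in> S"
  obtains \<eta> where "0 < \<eta>" "\<And>t. \<bar>t\<bar> < \<eta> \<Longrightarrow> x + t *\<^sub>R e \<in> S"
proof -
  have "((\<lambda>t. x + t *\<^sub>R e) \<longlongrightarrow> x + 0 *\<^sub>R e) (at (0::real))"
    by (intro tendsto_intros)
  then have "\<forall>\<^sub>F t in at (0::real). x + t *\<^sub>R e \<in> S"
    using assms topological_tendstoD by fastforce
  then obtain \<eta> where "0 < \<eta>" and "\<And>t. t \<noteq> 0 \<Longrightarrow> \<bar>t\<bar> < \<eta> \<Longrightarrow> x + t *\<^sub>R e \<in> S"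
    unfolding eventually_at by (auto simp: dist_real_def)
  with assms that show thesis
    by (metis add.right_neutral scaleR_zero_left)
qed

text \<open>The pointwise regularity behind second derivative tests along coordinate lines. It is
  weaker than C^2, as the second partial derivatives may be discontinuous.\<close>

definition twice_differentiable_on :: "(real^'n::finite \<Rightarrow> real) \<Rightarrow> (real^'n) set \<Rightarrow> bool" where
  "twice_differentiable_on f S \<longleftrightarrow>
     (\<forall>x\<in>S. f differentiable (at x) \<and> (\<forall>i. partial_deriv i f differentiable (at x)))"

lemma Ck_on_2_imp_twice_differentiable_on:
  "Ck_on 2 f S \<Longrightarrow> twice_differentiable_on f S"
  by (auto simp: twice_differentiable_on_def numeral_2_eq_2)

lemma twice_differentiable_on_imp_continuous_on:
  "twice_differentiable_on f S \<Longrightarrow> continuous_on S f"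
  by (meson continuous_at_imp_continuous_on differentiable_imp_continuous_within
      twice_differentiable_on_def)

text \<open>These turn each summand of \<open>laplacian\<close> into the second derivative of a
  function of one real variable.\<close>

lemma line_derivatives:
  assumes "twice_differentiable_on f S" "x + t *\<^sub>R axis i 1 \<in> S"
  shows "((\<lambda>t. f (x + t *\<^sub>R axis i 1)) has_real_derivative
           partial_deriv i f (x + t *\<^sub>R axis i 1)) (at t)"
    and "((\<lambda>t. partial_deriv i f (x + t *\<^sub>R axis i 1)) has_real_derivative
           partial_deriv i (partial_deriv i f) (x + t *\<^sub>R axis i 1)) (at t)"
  using assms has_real_derivative_line[of f x t "axis i 1", folded partial_deriv_def]
    has_real_derivative_line[of "partial_deriv i f" x t "axis i 1", folded partial_deriv_def]
  unfolding twice_differentiable_on_def by blast+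

text \<open>Applied to \<open>P\<close> and \<open>Q\<close>; the factor is the derivative of
  \<open>(d + a * s) * s\<close> in \<open>s\<close>.\<close>

lemma quadratic_twice_differentiable_on:
  assumes f: "twice_differentiable_on f S" and "open S"
  shows "twice_differentiable_on (\<lambda>y. (d + a * f y) * f y) S"
    and "\<And>x. x \<in> S \<Longrightarrow>
      partial_deriv i (\<lambda>y. (d + a * f y) * f y) x = (d + 2 * a * f x) * partial_deriv i f x"
proof -
  let ?F = "\<lambda>y. (d + a * f y) * f y"
  have D: "(?F has_derivative (\<lambda>h. (d + 2 * a * f x) * frechet_derivative f (at x) h)) (at x)"
    if "x \<in> S" for x
  proof -
    have "(f has_derivative frechet_derivative f (at x)) (at x)"
      using f that frechet_derivative_works unfolding twice_differentiable_on_def by blast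
    then show ?thesis
      by (auto intro!: derivative_eq_intros simp: algebra_simps)
  qed
  show pd: "partial_deriv i ?F x = (d + 2 * a * f x) * partial_deriv i f x" if "x \<in> S" for x i
    using frechet_derivative_at[OF D[OF that]] by (simp add: partial_deriv_def fun_eq_iff)
  show "twice_differentiable_on ?F S"
    unfolding twice_differentiable_on_def
  proof safe
    fix x assume x: "x \<in> S"
    show "?F differentiable at x"
      using D[OF x] differentiable_def by blast
    fix i
    have "(\<lambda>x. (d + 2 * a * f x) * partial_deriv i f x) differentiable at x"
      using f x by (auto simp: twice_differentiable_on_def)
    then obtain D where "((\<lambda>x. (d + 2 * a * f x) * partial_deriv i f x) has_derivative D) (at x)"
      unfolding differentiable_def by blast
    \<comment> \<open>The formula \<open>pd\<close> is known only on \<open>S\<close>; openness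
      makes it hold in a neighbourhood of \<open>x\<close>, which is what a derivative at
      \<open>x\<close> sees.\<close>
    then have "(partial_deriv i ?F has_derivative D) (at x)"
      by (rule has_derivative_transform_within_open[OF _ \<open>open S\<close> x]) (simp add: pd)
    then show "partial_deriv i ?F differentiable at x"
      by (rule differentiableI)
  qed
qed

text \<open>The second derivative test on each coordinate line through \<open>x\<close> makes every
  summand nonpositive.\<close>

lemma laplacian_nonpos_at_max:
  assumes "open S" "twice_differentiable_on f S" "x \<in> S" "\<And>y. y \<in> S \<Longrightarrow> f y \<le> f x"
  shows "laplacian f x \<le> 0"
  unfolding laplacian_def
proof (rule sum_nonpos)
  fix i
  obtain \<eta> where \<eta>: "0 < \<eta>" "\<And>t. \<bar>t\<bar> < \<eta> \<Longrightarrow> x + t *\<^sub>R axis i 1 \<in> S"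
    using open_line_nhd assms(1,3) by blast
  note L = line_derivatives[OF assms(2) \<eta>(2)]
  show "partial_deriv i (partial_deriv i f) x \<le> 0"
    using second_derivative_test_max(2)[OF \<eta>(1) L(1) L(2)[of 0, simplified]] \<eta> assms(4) by force
qed

subsection \<open>Strong maximum principle and Hopf's lemma\<close>

text \<open>For large \<open>\<alpha>\<close> the radial function \<open>exp (- \<alpha> \<rho>\<^sup>2) - exp (- \<alpha> r\<^sup>2)\<close> is a strict subsolution of
  \<open>\<Delta>b = K b\<close> in the annulus \<open>\<delta> < \<rho> < r\<close>; a small multiple of it lies below \<open>Q\<close>.\<close>

lemma exp_barrier_lower_bound:
  fixes Q :: "real^'n::finite \<Rightarrow> real"
  assumes \<delta>: "0 < \<delta>" "\<delta> < r" and "0 \<le> K"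
    and cont: "continuous_on (cball y r) Q"
    and diff: "twice_differentiable_on Q (ball y r)"
    and nonneg: "\<And>x. x \<in> cball y r \<Longrightarrow> 0 \<le> Q x"
    and pos: "\<And>x. x \<in> cball y \<delta> \<Longrightarrow> 0 < Q x"
    and lap: "\<And>x. x \<in> ball y r \<Longrightarrow> laplacian Q x \<le> K * Q x"
  obtains c where "0 < c" "\<And>x. x \<in> ball y r \<Longrightarrow> c * (r - dist x y) \<le> Q x"
proof -
  define n where "n = real CARD('n)"
  \<comment> \<open>Chosen so that \<open>4 * \<alpha> * \<delta>\<^sup>2 - 2 * n = 4 *
    \<delta>\<^sup>2 + K\<close>; at distance more than \<open>\<delta>\<close> from
    \<open>y\<close> this pushes \<open>4 * \<alpha>\<^sup>2 * (norm (x - y))\<^sup>2 - 2 * \<alpha>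
    * n\<close> above \<open>K\<close>.\<close>
  define \<alpha> where "\<alpha> = 1 + (2 * n + K) / (4 * \<delta>\<^sup>2)"
  define E where "E x = exp (- \<alpha> * (norm (x - y))\<^sup>2)" for x
  define b where "b x = E x - exp (- \<alpha> * r\<^sup>2)" for x
  have \<alpha>1: "1 \<le> \<alpha>"
    using \<open>0 \<le> K\<close> by (simp add: \<alpha>_def n_def)
  have \<alpha>2: "4 * \<alpha> * \<delta>\<^sup>2 = 4 * \<delta>\<^sup>2 + 2 * n + K"
    using \<delta> by (simp add: \<alpha>_def field_simps)
  have "continuous_on (cball y \<delta>) Q"
    using cont \<delta> by (auto elim: continuous_on_subset)
  then obtain q where q: "q \<in> cball y \<delta>" "\<And>x. x \<in> cball y \<delta> \<Longrightarrow> Q q \<le> Q x"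
    using continuous_attains_inf[of "cball y \<delta>" Q] \<delta> by fastforce
  \<comment> \<open>The minimum of \<open>Q\<close> on the inner ball: since \<open>b\<close> never
    exceeds 1, \<open>\<epsilon> * b\<close> lies below \<open>Q\<close> there.\<close>
  define \<epsilon> where "\<epsilon> = Q q"
  have \<epsilon>: "0 < \<epsilon>"
    using pos q by (simp add: \<epsilon>_def)
  have b1: "b x \<le> 1" for x
  proof -
    have "E x \<le> 1"
      using \<alpha>1 by (simp add: E_def)
    then show ?thesis
      using exp_ge_zero[of "- \<alpha> * r\<^sup>2"] unfolding b_def by linarith
  qed
  have "continuous_on (cball y r) (\<lambda>x. Q x - \<epsilon> * b x)"
    unfolding b_def E_def by (intro continuous_intros cont)
  then obtain x0 where x0: "x0 \<in> cball y r"
      "\<And>x. x \<in> cball y r \<Longrightarrow> Q x0 - \<epsilon> * b x0 \<le> Q x - \<epsilon> * b x"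
    using continuous_attains_inf[of "cball y r" "\<lambda>x. Q x - \<epsilon> * b x"] \<delta> by fastforce
  \<comment> \<open>A negative minimum cannot sit in the inner ball, nor on the outer sphere, where
    \<open>b\<close> vanishes. So \<open>x0\<close> would lie in the open annulus, where
    \<open>b\<close> is a strict subsolution.\<close>
  have min0: "0 \<le> Q x0 - \<epsilon> * b x0"
  proof (rule ccontr)
    assume neg: "\<not> 0 \<le> Q x0 - \<epsilon> * b x0"
    have "x0 \<notin> cball y \<delta>"
    proof
      assume "x0 \<in> cball y \<delta>"
      then have "\<epsilon> \<le> Q x0"
        using q by (simp add: \<epsilon>_def)
      moreover have "\<epsilon> * b x0 \<le> \<epsilon>"
        using b1[of x0] \<epsilon> by simp
      ultimately show False
        using neg by simp
    qed
    then have far: "\<delta> < norm (x0 - y)"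
      by (simp add: dist_norm norm_minus_commute)
    have "norm (x0 - y) \<noteq> r"
    proof
      assume "norm (x0 - y) = r"
      then have "b x0 = 0"
        by (simp add: b_def E_def)
      with neg nonneg[OF x0(1)] show False
        by simp
    qed
    then have x0b: "x0 \<in> ball y r"
      using x0(1) by (simp add: dist_norm norm_minus_commute)
    \<comment> \<open>At a minimum of \<open>Q - \<epsilon> * b\<close> each second partial
      derivative of \<open>\<epsilon> * b\<close> is at most that of \<open>Q\<close>. The left side
      is this derivative, computed from the Gaussian \<open>B\<close> on the line
      \<open>z\<close>.\<close>
    have lower: "\<epsilon> * (E x0 * (4 * \<alpha>\<^sup>2 * ((x0 - y) $ i)\<^sup>2 - 2 * \<alpha>))
        \<le> partial_deriv i (partial_deriv i Q) x0" for i
    proof -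
      define m where "m = (x0 - y) $ i"
      define z where "z t = x0 + t *\<^sub>R axis i 1" for t :: real
      define B where "B t = exp (- \<alpha> * ((norm (x0 - y))\<^sup>2 + 2 * t * m + t\<^sup>2))" for t
      have nz: "(norm (z t - y))\<^sup>2 = (norm (x0 - y))\<^sup>2 + 2 * t * m + t\<^sup>2" for t
      proof -
        have "z t - y = (x0 - y) + t *\<^sub>R axis i 1"
          by (simp add: z_def)
        moreover have "(norm ((x0 - y) + t *\<^sub>R axis i 1))\<^sup>2 =
            (norm (x0 - y))\<^sup>2 + 2 * ((x0 - y) \<bullet> (t *\<^sub>R axis i 1)) + (norm (t *\<^sub>R axis i (1::real) :: real^'n))\<^sup>2"
          unfolding power2_norm_eq_inner by (simp only: inner_add_left inner_add_right inner_commute)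
        moreover have "(x0 - y) \<bullet> (t *\<^sub>R axis i 1) = t * m"
          by (simp add: inner_axis m_def)
        moreover have "(norm (t *\<^sub>R axis i (1::real) :: real^'n))\<^sup>2 = t\<^sup>2"
          by simp
        ultimately show ?thesis
          by (simp only: mult.assoc)
      qed
      have bz: "b (z t) = B t - exp (- \<alpha> * r\<^sup>2)" for t
        by (simp only: b_def E_def B_def nz)
      obtain \<eta> where \<eta>: "0 < \<eta>" "\<And>t. \<bar>t\<bar> < \<eta> \<Longrightarrow> z t \<in> ball y r"
        unfolding z_def using open_line_nhd[OF open_ball x0b] by blast
      have Q1: "((\<lambda>t. Q (z t)) has_real_derivative partial_deriv i Q (z t)) (at t)"
        and Q2: "((\<lambda>t. partial_deriv i Q (z t)) has_real_derivative
          partial_deriv i (partial_deriv i Q) (z t)) (at t)" if "\<bar>t\<bar> < \<eta>" for t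
        using line_derivatives[OF diff] \<eta>(2)[OF that] unfolding z_def by blast+
      have B1: "(B has_real_derivative - \<alpha> * (2 * m + 2 * t) * B t) (at t)" for t
        unfolding B_def by (auto intro!: derivative_eq_intros)
      have B2: "((\<lambda>t. - \<alpha> * (2 * m + 2 * t) * B t) has_real_derivative
          (4 * \<alpha>\<^sup>2 * m\<^sup>2 - 2 * \<alpha>) * B 0) (at 0)"
        by (rule derivative_eq_intros B1 refl)+ (simp add: algebra_simps power2_eq_square)
      have z0: "z 0 = x0"
        by (simp add: z_def)
      have "\<epsilon> * ((4 * \<alpha>\<^sup>2 * m\<^sup>2 - 2 * \<alpha>) * B 0) - partial_deriv i (partial_deriv i Q) (z 0) \<le> 0"
      proof (rule second_derivative_test_max(2)[OF \<eta>(1)])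
        fix t assume t: "\<bar>t\<bar> < \<eta>"
        show "((\<lambda>t. \<epsilon> * (B t - exp (- \<alpha> * r\<^sup>2)) - Q (z t)) has_real_derivative
            \<epsilon> * (- \<alpha> * (2 * m + 2 * t) * B t) - partial_deriv i Q (z t)) (at t)"
          by (rule derivative_eq_intros B1 Q1[OF t] refl)+ simp
        show "\<epsilon> * (B t - exp (- \<alpha> * r\<^sup>2)) - Q (z t) \<le> \<epsilon> * (B 0 - exp (- \<alpha> * r\<^sup>2)) - Q (z 0)"
          using x0(2)[OF subsetD[OF ball_subset_cball \<eta>(2)[OF t]]] unfolding bz[symmetric] z0 by linarith
      next
        show "((\<lambda>t. \<epsilon> * (- \<alpha> * (2 * m + 2 * t) * B t) - partial_deriv i Q (z t)) has_real_derivative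
          \<epsilon> * ((4 * \<alpha>\<^sup>2 * m\<^sup>2 - 2 * \<alpha>) * B 0) - partial_deriv i (partial_deriv i Q) (z 0)) (at 0)"
          using \<eta>(1) by (intro DERIV_diff DERIV_cmult B2 Q2) auto
      qed
      moreover have "B 0 = E x0"
        by (simp add: B_def E_def)
      ultimately show ?thesis
        by (simp add: z0 m_def mult.commute)
    qed
    have sq: "(\<Sum>i\<in>UNIV. ((x0 - y) $ i)\<^sup>2) = (norm (x0 - y))\<^sup>2"
      by (simp add: norm_vec_def L2_set_def sum_nonneg)
    \<comment> \<open>Summing over the coordinates and cancelling \<open>\<epsilon> * E x0\<close>
      leads to a bound that contradicts the choice of \<open>\<alpha>\<close>.\<close>
    have "\<epsilon> * E x0 * (4 * \<alpha>\<^sup>2 * (norm (x0 - y))\<^sup>2 - 2 * \<alpha> * n)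
        = (\<Sum>i\<in>UNIV. \<epsilon> * (E x0 * (4 * \<alpha>\<^sup>2 * ((x0 - y) $ i)\<^sup>2 - 2 * \<alpha>)))"
      unfolding sum_distrib_left[symmetric] sum_subtractf sq by (simp add: n_def mult.assoc)
    also have "\<dots> \<le> laplacian Q x0"
      unfolding laplacian_def by (intro sum_mono lower)
    also have "\<dots> \<le> K * Q x0"
      using lap x0b by simp
    also have "\<dots> \<le> K * (\<epsilon> * b x0)"
      using neg \<open>0 \<le> K\<close> by (intro mult_left_mono) auto
    also have "\<dots> \<le> K * (\<epsilon> * E x0)"
      using \<epsilon> \<open>0 \<le> K\<close> by (intro mult_left_mono) (auto simp: b_def)
    finally have "(\<epsilon> * E x0) * (4 * \<alpha>\<^sup>2 * (norm (x0 - y))\<^sup>2 - 2 * \<alpha> * n) \<le> (\<epsilon> * E x0) * K"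
      by (simp add: mult_ac)
    then have "4 * \<alpha>\<^sup>2 * (norm (x0 - y))\<^sup>2 - 2 * \<alpha> * n \<le> K"
      using \<epsilon> by (simp add: E_def)
    moreover have "\<delta>\<^sup>2 \<le> (norm (x0 - y))\<^sup>2"
      using far \<delta> by (intro power_mono) auto
    then have "4 * \<alpha>\<^sup>2 * \<delta>\<^sup>2 \<le> 4 * \<alpha>\<^sup>2 * (norm (x0 - y))\<^sup>2"
      by (intro mult_left_mono) auto
    moreover have "4 * \<alpha>\<^sup>2 * \<delta>\<^sup>2 - 2 * \<alpha> * n = \<alpha> * (4 * \<delta>\<^sup>2 + K)"
    proof -
      have "4 * \<alpha>\<^sup>2 * \<delta>\<^sup>2 = \<alpha> * (4 * \<alpha> * \<delta>\<^sup>2)"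
        by (simp add: power2_eq_square)
      then show ?thesis
        unfolding \<alpha>2 by (simp add: algebra_simps)
    qed
    moreover have "4 * \<delta>\<^sup>2 + K \<le> \<alpha> * (4 * \<delta>\<^sup>2 + K)"
      using \<alpha>1 \<open>0 \<le> K\<close> mult_right_mono[of 1 \<alpha> "4 * \<delta>\<^sup>2 + K"] by simp
    moreover have "0 < \<delta>\<^sup>2"
      using \<delta> by simp
    ultimately show False
      by linarith
  qed
  \<comment> \<open>Linear lower bound for \<open>\<epsilon> * b\<close>: with \<open>\<rho>\<close>
    the distance to \<open>y\<close>, use \<open>1 + s \<le> exp s\<close> at
    \<open>s = \<alpha> * (r\<^sup>2 - \<rho>\<^sup>2)\<close> and
    \<open>r * (r - \<rho>) \<le> r\<^sup>2 - \<rho>\<^sup>2\<close>.\<close>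
  define c where "c = \<epsilon> * (exp (- \<alpha> * r\<^sup>2) * (\<alpha> * r))"
  show thesis
  proof
    show "0 < c"
      using \<epsilon> \<alpha>1 \<delta> by (simp add: c_def)
    fix x assume x: "x \<in> ball y r"
    define \<rho> where "\<rho> = norm (x - y)"
    have \<rho>: "0 \<le> \<rho>" "\<rho> < r" "dist x y = \<rho>"
      using x by (auto simp: \<rho>_def dist_norm norm_minus_commute)
    have "r * (r - \<rho>) \<le> r\<^sup>2 - \<rho>\<^sup>2"
      using mult_right_mono[of \<rho> r \<rho>] \<rho> by (simp add: algebra_simps power2_eq_square)
    then have "\<alpha> * r * (r - \<rho>) \<le> \<alpha> * (r\<^sup>2 - \<rho>\<^sup>2)"
      using \<alpha>1 mult_left_mono[of "r * (r - \<rho>)" "r\<^sup>2 - \<rho>\<^sup>2" \<alpha>] by (simp add: mult.assoc)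
    also have "\<dots> \<le> exp (\<alpha> * (r\<^sup>2 - \<rho>\<^sup>2)) - 1"
      using exp_ge_add_one_self[of "\<alpha> * (r\<^sup>2 - \<rho>\<^sup>2)"] by linarith
    finally have "exp (- \<alpha> * r\<^sup>2) * (\<alpha> * r * (r - \<rho>)) \<le> exp (- \<alpha> * r\<^sup>2) * (exp (\<alpha> * (r\<^sup>2 - \<rho>\<^sup>2)) - 1)"
      by (intro mult_left_mono) auto
    also have "\<dots> = b x"
      unfolding b_def E_def \<rho>_def[symmetric] right_diff_distrib
      by (simp add: algebra_simps flip: exp_add)
    finally have "exp (- \<alpha> * r\<^sup>2) * (\<alpha> * r * (r - \<rho>)) \<le> b x" .
    then have "c * (r - \<rho>) \<le> \<epsilon> * b x"
      using \<epsilon> mult_left_mono[of "exp (- \<alpha> * r\<^sup>2) * (\<alpha> * r * (r - \<rho>))" "b x" \<epsilon>]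
      by (simp add: c_def mult.assoc)
    also have "\<dots> \<le> Q x"
      using x0(2)[of x] x min0 by auto
    finally show "c * (r - dist x y) \<le> Q x"
      by (simp add: \<rho>)
  qed
qed

text \<open>The positivity set of \<open>Q\<close> is open, and so is its complement in
  \<open>S\<close>: the barrier would carry a positive value near a zero over to that zero.
  Connectedness does the rest.\<close>

lemma strong_minimum_principle:
  fixes Q :: "real^'n::finite \<Rightarrow> real"
  assumes "open S" "connected S" "0 \<le> K"
    and diff: "twice_differentiable_on Q S"
    and nonneg: "\<And>x. x \<in> S \<Longrightarrow> 0 \<le> Q x"
    and lap: "\<And>x. x \<in> S \<Longrightarrow> laplacian Q x \<le> K * Q x"
    and x1: "x1 \<in> S" "Q x1 \<noteq> 0"
    and x: "x \<in> S"
  shows "0 < Q x"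
proof -
  have cont: "continuous_on S Q"
    using diff by (rule twice_differentiable_on_imp_continuous_on)
  define A where "A = {x \<in> S. 0 < Q x}"
  have "A = S \<inter> Q -` {0<..}"
    by (auto simp: A_def)
  then have "open A"
    using continuous_open_preimage[OF cont \<open>open S\<close> open_greaterThan] by simp
  moreover have "open (S - A)"
    unfolding open_contains_ball
  proof
    fix z assume z: "z \<in> S - A"
    then obtain e where e: "0 < e" "cball z e \<subseteq> S"
      using \<open>open S\<close> by (auto simp: open_contains_cball)
    \<comment> \<open>Half of \<open>e\<close>, so that for every \<open>y\<close> in
      \<open>ball z r\<close> the ball \<open>cball y r\<close> stays in \<open>S\<close> while
      \<open>ball y r\<close> still contains \<open>z\<close>.\<close>
    define r where "r = e / 2"
    have r: "0 < r"
      using e by (simp add: r_def)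
    have "ball z r \<subseteq> S - A"
    proof
      fix y assume y: "y \<in> ball z r"
      have "cball y r \<subseteq> cball z e"
      proof
        fix w assume "w \<in> cball y r"
        then show "w \<in> cball z e"
          using dist_triangle[of z w y] y by (simp add: r_def)
      qed
      with e(2) have sub: "cball y r \<subseteq> S"
        by blast
      then have "y \<in> S"
        using r by auto
      moreover have "y \<notin> A"
      proof
        assume "y \<in> A"
        then obtain d where d: "0 < d" "cball y d \<subseteq> A"
          using \<open>open A\<close> by (auto simp: open_contains_cball)
        define \<delta> where "\<delta> = min d (r / 2)"
        have \<delta>: "0 < \<delta>" "\<delta> < r" "cball y \<delta> \<subseteq> A"
          using d r by (auto simp: \<delta>_def)
        have sub': "ball y r \<subseteq> S"
          using sub ball_subset_cball by blast
        obtain c where c: "0 < c" "\<And>x. x \<in> ball y r \<Longrightarrow> c * (r - dist x y) \<le> Q x"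
        proof (rule exp_barrier_lower_bound[OF \<delta>(1,2) \<open>0 \<le> K\<close>, of y Q])
          show "continuous_on (cball y r) Q"
            using cont sub continuous_on_subset by blast
          show "twice_differentiable_on Q (ball y r)"
            using diff sub' by (auto simp: twice_differentiable_on_def)
        qed (use nonneg lap sub sub' \<delta>(3) in \<open>auto simp: A_def\<close>)
        have "z \<in> ball y r"
          using y by (simp add: dist_commute)
        moreover from this have "0 < c * (r - dist z y)"
          using c(1) by (simp add: dist_commute)
        ultimately have "0 < Q z"
          using c(2) by fastforce
        with z show False
          by (simp add: A_def)
      qed
      ultimately show "y \<in> S - A"
        by simp
    qed
    with r show "\<exists>e>0. ball z e \<subseteq> S - A"
      by blast
  qed
  ultimately have "A \<inter> S = {} \<or> (S - A) \<inter> S = {}"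
    using connectedD[OF \<open>connected S\<close>, of A "S - A"] by blast
  moreover have "x1 \<in> A"
    using x1 nonneg[of x1] by (simp add: A_def)
  ultimately show ?thesis
    using x x1 by (auto simp: A_def)
qed

subsection \<open>Comparison near the boundary\<close>

text \<open>A directional derivative is the combination of the partial derivatives with the
  coordinates of \<open>e\<close> as coefficients, so their extensions combine in the same
  way.\<close>

lemma C1_closure_directional:
  fixes f :: "real^'n::finite \<Rightarrow> real"
  assumes "C1_closure f \<Omega>"
  obtains G where "continuous_on (closure \<Omega>) G"
    "\<And>x. x \<in> \<Omega> \<Longrightarrow> frechet_derivative f (at x) e = G x"
proof -
  obtain g where g: "\<And>i. continuous_on (closure \<Omega>) (g i)"
      "\<And>i x. x \<in> \<Omega> \<Longrightarrow> g i x = partial_deriv i f x"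
    using assms unfolding C1_closure_def by metis
  show thesis
  proof
    show "continuous_on (closure \<Omega>) (\<lambda>x. \<Sum>i\<in>UNIV. e $ i * g i x)"
      by (intro continuous_intros g)
    fix x assume x: "x \<in> \<Omega>"
    let ?D = "frechet_derivative f (at x)"
    have "f differentiable (at x)"
      using assms x by (simp add: C1_closure_def)
    then have lin: "linear ?D"
      by (rule linear_frechet_derivative)
    have "?D e = ?D (\<Sum>i\<in>UNIV. e $ i *\<^sub>R axis i 1)"
      using basis_expansion[of e] by (simp add: scalar_mult_eq_scaleR)
    also have "\<dots> = (\<Sum>i\<in>UNIV. e $ i * ?D (axis i 1))"
      by (simp add: linear_sum[OF lin] linear_cmul[OF lin])
    finally show "?D e = (\<Sum>i\<in>UNIV. e $ i * g i x)"
      using x by (simp add: g partial_deriv_def)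
  qed
qed

text \<open>The mean value theorem for a segment that may start on the boundary: \<open>f\<close> is
  continuous up to \<open>p\<close>, and differentiability is used only at points inside
  \<open>\<Omega>\<close>.\<close>

lemma C1_closure_mvt:
  fixes f :: "real^'n::finite \<Rightarrow> real"
  assumes f: "C1_closure f \<Omega>"
    and G: "\<And>x. x \<in> \<Omega> \<Longrightarrow> frechet_derivative f (at x) e = G x"
    and "0 < h" and p: "p \<in> closure \<Omega>"
    and seg: "\<And>s. 0 < s \<Longrightarrow> s \<le> h \<Longrightarrow> p + s *\<^sub>R e \<in> \<Omega>"
  obtains z where "0 < z" "z < h" "f (p + h *\<^sub>R e) - f p = h * G (p + z *\<^sub>R e)"
proof -
  have cont: "continuous_on (closure \<Omega>) f"
    using f by (simp add: C1_closure_def)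
  have "continuous_on {0..h} (\<lambda>s. f (p + s *\<^sub>R e))"
  proof (rule continuous_on_compose2[OF cont])
    show "(\<lambda>s. p + s *\<^sub>R e) ` {0..h} \<subseteq> closure \<Omega>"
    proof safe
      fix s assume "s \<in> {0..h}"
      then show "p + s *\<^sub>R e \<in> closure \<Omega>"
        using p seg[of s] closure_subset by (cases "s = 0") auto
    qed
  qed (intro continuous_intros)
  moreover have D: "((\<lambda>s. f (p + s *\<^sub>R e)) has_real_derivative G (p + s *\<^sub>R e)) (at s)"
    if "0 < s" "s < h" for s
  proof -
    have "p + s *\<^sub>R e \<in> \<Omega>"
      using seg that by simp
    then show ?thesis
      using has_real_derivative_line[of f p s e] f G by (simp add: C1_closure_def)
  qed
  ultimately obtain l z where z: "0 < z" "z < h"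
      "((\<lambda>s. f (p + s *\<^sub>R e)) has_real_derivative l) (at z)"
      "f (p + h *\<^sub>R e) - f (p + 0 *\<^sub>R e) = (h - 0) * l"
    using MVT[OF \<open>0 < h\<close>, of "\<lambda>s. f (p + s *\<^sub>R e)"] real_differentiable_def
    by blast
  then have "l = G (p + z *\<^sub>R e)"
    using D DERIV_unique by blast
  with z that show thesis
    by simp
qed

text \<open>\<open>H\<close> is the height above the boundary graph and \<open>e\<close> the
  direction that \<open>T\<close> maps to axis \<open>k\<close>. As \<open>\<gamma>\<close> ignores
  coordinate \<open>k\<close>, a step along \<open>e\<close> changes the height by exactly its
  length.\<close>

lemma smooth_boundary_height:
  fixes \<Omega> :: "(real^'n::finite) set"
  assumes "open \<Omega>" "smooth_boundary \<Omega>" "p \<in> frontier \<Omega>"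
  obtains r e H where "0 < r" "norm e = 1" "\<And>x. H differentiable (at x)"
    "\<And>x s. H (x + s *\<^sub>R e) = H x + s" "H p = (0::real)"
    "\<And>x. x \<in> ball p r \<Longrightarrow> x \<in> \<Omega> \<longleftrightarrow> 0 < H x"
proof -
  obtain r T k \<gamma> where r: "0 < r" and T: "orthogonal_transformation (T :: real^'n \<Rightarrow> real^'n)"
    and \<gamma>: "smooth_on \<gamma> UNIV" and inv: "\<And>y s. \<gamma> (y + s *\<^sub>R axis k 1) = \<gamma> y"
    and \<Omega>: "\<Omega> \<inter> ball p r = {x \<in> ball p r. \<gamma> (T x) < T x $ k}"
    using bspec[OF assms(2)[unfolded smooth_boundary_def] assms(3)]
    by (elim exE conjE) (rule that; simp)
  obtain e where e: "T e = axis k 1"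
    using orthogonal_transformation_surj[OF T] unfolding surj_def by metis
  define H where "H x = T x $ k - \<gamma> (T x)" for x
  have lin: "linear T"
    using T by (rule orthogonal_transformation_linear)
  have "Ck_on (Suc 0) \<gamma> UNIV"
    using \<gamma> unfolding smooth_on_def by blast
  then have \<gamma>d: "\<gamma> differentiable (at x)" for x
    by simp
  have Td: "T differentiable (at x)" for x
    using lin by (simp add: linear_imp_differentiable)
  have Hd: "H differentiable (at x)" for x
  proof -
    have "(\<lambda>x. \<gamma> (T x)) differentiable (at x)"
      using differentiable_chain_at[OF Td \<gamma>d] by (simp add: o_def)
    moreover have "(\<lambda>x. T x $ k) differentiable (at x)"
      using differentiable_chain_at[OF Td
          bounded_linear_imp_differentiable[OF bounded_linear_vec_nth[of k]], of x]
      by (simp add: o_def)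
    ultimately show ?thesis
      unfolding H_def by (intro differentiable_diff)
  qed
  have near: "x \<in> \<Omega> \<longleftrightarrow> 0 < H x" if "x \<in> ball p r" for x
    using that set_eq_iff[THEN iffD1, OF \<Omega>, rule_format, of x] by (simp add: H_def)
  have "p \<notin> \<Omega>"
    using assms by (simp add: frontier_def interior_open)
  then have "H p \<le> 0"
    using near[of p] r by simp
  \<comment> \<open>A negative height at \<open>p\<close> would persist nearby and keep
    \<open>\<Omega>\<close> away from \<open>p\<close>, which lies in its closure.\<close>
  moreover have "\<not> H p < 0"
  proof
    assume "H p < 0"
    have "(H \<longlongrightarrow> H p) (at p)"
      using differentiable_imp_continuous_within[OF Hd] by (rule isContD)
    then have "\<forall>\<^sub>F x in at p. H x < 0"
      using \<open>H p < 0\<close> by (rule order_tendstoD)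
    then obtain d where d: "0 < d" "\<And>x. x \<noteq> p \<Longrightarrow> dist x p < d \<Longrightarrow> H x < 0"
      unfolding eventually_at by auto
    have "p \<in> closure \<Omega>"
      using assms(3) by (simp add: frontier_def)
    then obtain x where x: "x \<in> \<Omega>" "dist x p < min d r"
      using d(1) r by (metis closure_approachable min_less_iff_conj)
    with \<open>p \<notin> \<Omega>\<close> d(2)[of x] near[of x] show False
      by (auto simp: dist_commute)
  qed
  ultimately have "H p = 0"
    by simp
  moreover have "norm e = 1"
    using orthogonal_transformation_norm[OF T, of e] e by simp
  moreover have "H (x + s *\<^sub>R e) = H x + s" for x s
    by (simp add: H_def linear_add[OF lin] linear_cmul[OF lin] e inv)
  ultimately show thesis
    by (intro that[OF r _ Hd _ _ near])
qed

text \<open>Otherwise \<open>- e\<close>, perturbed slightly towards \<open>y\<close>, points from \<open>p\<close> into the ball,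
  while the height \<open>H\<close> decreases along it.\<close>

lemma interior_ball_transversal:
  fixes \<Omega> :: "'a::euclidean_space set"
  assumes "0 < r" "norm e = 1" "H differentiable (at p)"
    and shift: "\<And>x s. H (x + s *\<^sub>R e) = H x + s" and "H p = (0::real)"
    and near: "\<And>x. x \<in> ball p r \<Longrightarrow> x \<in> \<Omega> \<longleftrightarrow> 0 < H x"
    and "0 < R" "ball y R \<subseteq> \<Omega>" "p \<in> sphere y R"
  shows "0 < e \<bullet> (y - p)"
proof (rule ccontr)
  assume neg: "\<not> 0 < e \<bullet> (y - p)"
  define \<nu> where "\<nu> = y - p"
  define L where "L = frechet_derivative H (at p) \<nu>"
  have n\<nu>: "norm \<nu> = R"
    using assms by (simp add: \<nu>_def dist_norm)
  have D: "((\<lambda>s. H (p + s *\<^sub>R \<nu>)) has_real_derivative L) (at 0)"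
    using has_real_derivative_line[of H p 0 \<nu>] assms by (simp add: L_def)
  \<comment> \<open>So small that for small positive \<open>t\<close> the step
    \<open>(t * \<eta>) *\<^sub>R \<nu>\<close> raises \<open>H\<close> by less than
    \<open>t\<close>, while the step \<open>- t *\<^sub>R e\<close> lowers it by exactly
    \<open>t\<close>.\<close>
  define \<eta> where "\<eta> = 1 / (\<bar>L\<bar> + 1)"
  have \<eta>: "0 < \<eta>" "\<eta> * (\<bar>L\<bar> + 1) = 1"
    by (auto simp: \<eta>_def field_simps)
  define w where "w = \<eta> *\<^sub>R \<nu> - e"
  have w\<nu>: "0 < w \<bullet> \<nu>"
  proof -
    have "\<nu> \<bullet> \<nu> = R\<^sup>2"
      using n\<nu> by (simp add: dot_square_norm)
    then have "w \<bullet> \<nu> = \<eta> * R\<^sup>2 - e \<bullet> \<nu>"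
      by (simp add: w_def inner_diff_left)
    moreover have "0 < \<eta> * R\<^sup>2"
      using \<eta> \<open>0 < R\<close> by simp
    ultimately show ?thesis
      using neg by (simp add: \<nu>_def)
  qed
  have ev1: "\<forall>\<^sub>F t in at_right (0::real). p + t *\<^sub>R w \<in> ball p r"
  proof -
    have "((\<lambda>t. p + t *\<^sub>R w) \<longlongrightarrow> p + 0 *\<^sub>R w) (at_right (0::real))"
      by (intro tendsto_intros)
    then show ?thesis
      using topological_tendstoD[OF _ open_ball, of _ p _ p r] \<open>0 < r\<close> by simp
  qed
  have ev2: "\<forall>\<^sub>F t in at_right (0::real). p + t *\<^sub>R w \<in> ball y R"
  proof -
    have "((\<lambda>t. t * (norm w)\<^sup>2) \<longlongrightarrow> 0 * (norm w)\<^sup>2) (at_right (0::real))"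
      by (intro tendsto_intros)
    then have "\<forall>\<^sub>F t in at_right (0::real). t * (norm w)\<^sup>2 < 2 * (w \<bullet> \<nu>)"
      using order_tendstoD(2)[of _ "0 * (norm w)\<^sup>2" _ "2 * (w \<bullet> \<nu>)"] w\<nu> by simp
    then show ?thesis
      using eventually_at_right_less
    proof eventually_elim
      case (elim t)
      have "(norm (\<nu> - t *\<^sub>R w))\<^sup>2 = R\<^sup>2 - 2 * t * (w \<bullet> \<nu>) + t * (t * (norm w)\<^sup>2)"
        by (simp add: power2_norm_eq_inner inner_diff_left inner_diff_right inner_commute algebra_simps flip: n\<nu>)
      also have "\<dots> < R\<^sup>2"
        using elim mult_strict_left_mono[of "t * (norm w)\<^sup>2" "2 * (w \<bullet> \<nu>)" t] by simp
      finally have "norm (\<nu> - t *\<^sub>R w) < R"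
        using \<open>0 < R\<close> by (simp add: power_less_imp_less_base)
      then show ?case
        by (simp add: \<nu>_def dist_norm algebra_simps)
    qed
  qed
  have ev3: "\<forall>\<^sub>F t in at_right (0::real). H (p + t *\<^sub>R w) \<le> 0"
  proof -
    have "((\<lambda>s. (H (p + s *\<^sub>R \<nu>) - H p) / s) \<longlongrightarrow> L) (at 0)"
      using D by (simp add: DERIV_def)
    then have "\<forall>\<^sub>F s in at 0. (H (p + s *\<^sub>R \<nu>) - H p) / s < \<bar>L\<bar> + 1"
      by (rule order_tendstoD) simp
    then obtain d where d: "0 < d"
        "\<And>s. s \<noteq> 0 \<Longrightarrow> \<bar>s\<bar> < d \<Longrightarrow> H (p + s *\<^sub>R \<nu>) / s < \<bar>L\<bar> + 1"
      using \<open>H p = 0\<close> unfolding eventually_at by (auto simp: dist_real_def)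
    have "\<forall>\<^sub>F t in at_right (0::real). t < d / \<eta>"
      using d(1) \<eta>(1) by (intro order_tendstoD(2)[OF tendsto_ident_at]) simp
    then show ?thesis
      using eventually_at_right_less
    proof eventually_elim
      case (elim t)
      define s where "s = t * \<eta>"
      have s: "0 < s" "s < d"
        using elim \<eta> by (auto simp: s_def field_simps)
      then have "H (p + s *\<^sub>R \<nu>) < s * (\<bar>L\<bar> + 1)"
        using d(2)[of s] by (simp add: field_simps)
      also have "s * (\<bar>L\<bar> + 1) = t"
        using \<eta>(2) by (simp add: s_def mult.assoc)
      finally have "H (p + s *\<^sub>R \<nu> + (- t) *\<^sub>R e) < 0"
        using shift[of "p + s *\<^sub>R \<nu>" "- t"] by simp
      moreover have "p + s *\<^sub>R \<nu> + (- t) *\<^sub>R e = p + t *\<^sub>R w"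
        by (simp add: s_def w_def algebra_simps)
      ultimately show ?case
        by (simp only: less_imp_le)
    qed
  qed
  \<comment> \<open>For small \<open>t\<close> the point \<open>p + t *\<^sub>R w\<close> lies in
    the interior ball, hence in \<open>\<Omega>\<close>, yet has nonpositive height.\<close>
  have "\<forall>\<^sub>F t in at_right (0::real). False"
    using ev1 ev2 ev3
  proof eventually_elim
    case (elim t)
    then show ?case
      using near[of "p + t *\<^sub>R w"] assms by auto
  qed
  then show False
    by simp
qed

text \<open>Hopf's lemma makes the derivative of \<open>v\<close> along the graph direction \<open>e\<close> positive at \<open>p\<close>, hence
  bounded below near \<open>p\<close>; integrate along \<open>e\<close> from the boundary.\<close>

lemma boundary_comparison:
  fixes \<Omega> :: "(real^'n::finite) set" and u v :: "real^'n \<Rightarrow> real"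
  assumes "open \<Omega>" "smooth_boundary \<Omega>" "interior_ball_condition \<Omega>" and p: "p \<in> frontier \<Omega>"
    and u: "C1_closure u \<Omega>" and v: "C1_closure v \<Omega>"
    and zero: "\<And>x. x \<in> frontier \<Omega> \<Longrightarrow> u x = 0 \<and> v x = 0"
    and hopf: "\<And>y R. 0 < R \<Longrightarrow> ball y R \<subseteq> \<Omega> \<Longrightarrow>
      \<exists>c>0. \<forall>x\<in>ball y R. c * (R - dist x y) \<le> v x"
  obtains K \<delta> where "0 < \<delta>" "0 \<le> K" "\<And>x. x \<in> \<Omega> \<Longrightarrow> dist x p < \<delta> \<Longrightarrow> u x \<le> K * v x"
proof -
  obtain r e H where r: "0 < r" and e: "norm e = 1" and Hd: "\<And>x. H differentiable (at x)"
    and shift: "\<And>x s. H (x + s *\<^sub>R e) = H x + s" and Hp: "H p = (0::real)"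
    and near: "\<And>x. x \<in> ball p r \<Longrightarrow> x \<in> \<Omega> \<longleftrightarrow> 0 < H x"
    using smooth_boundary_height[OF assms(1,2) p] by metis
  obtain y R where R: "0 < R" "ball y R \<subseteq> \<Omega>" "p \<in> sphere y R"
    using assms(3) p unfolding interior_ball_condition_def by blast
  define \<mu> where "\<mu> = e \<bullet> (y - p)"
  have \<mu>: "0 < \<mu>"
    unfolding \<mu>_def by (rule interior_ball_transversal[OF r e Hd shift Hp near R])
  obtain c where c: "0 < c" "\<And>x. x \<in> ball y R \<Longrightarrow> c * (R - dist x y) \<le> v x"
    using hopf[OF R(1,2)] by blast
  obtain U where Uc: "continuous_on (closure \<Omega>) U"
    and U: "\<And>x. x \<in> \<Omega> \<Longrightarrow> frechet_derivative u (at x) e = U x"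
    using C1_closure_directional[OF u] by blast
  obtain V where Vc: "continuous_on (closure \<Omega>) V"
    and V: "\<And>x. x \<in> \<Omega> \<Longrightarrow> frechet_derivative v (at x) e = V x"
    using C1_closure_directional[OF v] by blast
  have pc: "p \<in> closure \<Omega>"
    using p by (simp add: frontier_def)
  \<comment> \<open>For \<open>0 < t < \<mu>\<close> the point \<open>p + t *\<^sub>R e\<close> lies
    at depth at least \<open>t * \<mu> / (2 * R)\<close> below the sphere, which Hopf's bound turns
    into \<open>q * t \<le> v\<close>.\<close>
  define q where "q = c * \<mu> / (2 * R)"
  have q: "0 < q"
    using c \<mu> R by (simp add: q_def)
  have growth: "q * t \<le> v (p + t *\<^sub>R e)" if t: "0 < t" "t < \<mu>" for t
  proof -
    define \<rho> where "\<rho> = dist (p + t *\<^sub>R e) y"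
    have "dist p y = R"
      using R(3) by (simp add: dist_commute)
    moreover have "\<rho>\<^sup>2 = (dist p y)\<^sup>2 - 2 * t * \<mu> + t * t * (norm e)\<^sup>2"
      by (simp add: \<rho>_def \<mu>_def dist_norm power2_norm_eq_inner inner_diff_left inner_diff_right
          inner_add_left inner_add_right inner_commute algebra_simps)
    ultimately have "\<rho>\<^sup>2 = R\<^sup>2 - 2 * t * \<mu> + t * t"
      by (simp add: e)
    moreover have "t * t < t * \<mu>"
      using t by simp
    ultimately have gap: "t * \<mu> < R\<^sup>2 - \<rho>\<^sup>2"
      by linarith
    moreover have "0 < t * \<mu>"
      using t \<mu> by simp
    ultimately have "\<rho>\<^sup>2 < R\<^sup>2"
      by linarith
    then have \<rho>: "0 \<le> \<rho>" "\<rho> < R"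
      using R(1) power_less_imp_less_base[of \<rho> 2 R] by (auto simp: \<rho>_def)
    have "t * \<mu> < (R - \<rho>) * (R + \<rho>)"
      using gap by (simp add: algebra_simps power2_eq_square)
    also have "\<dots> \<le> (R - \<rho>) * (2 * R)"
      using \<rho> by (intro mult_left_mono) auto
    finally have "c * (t * \<mu>) \<le> c * ((R - \<rho>) * (2 * R))"
      using c(1) by (intro mult_left_mono) auto
    then have "q * t \<le> c * (R - \<rho>)"
      using R(1) by (simp add: q_def field_simps)
    also have "\<dots> \<le> v (p + t *\<^sub>R e)"
      using c(2)[of "p + t *\<^sub>R e"] \<rho> by (simp add: \<rho>_def dist_commute)
    finally show ?thesis .
  qed
  have inside: "p + t *\<^sub>R e \<in> \<Omega>" if "0 < t" "t < r" for t
    using near[of "p + t *\<^sub>R e"] that e by (simp add: shift Hp dist_norm)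
  have Vt: "(V \<longlongrightarrow> V p) (at p within closure \<Omega>)" and Ut: "(U \<longlongrightarrow> U p) (at p within closure \<Omega>)"
    using Vc Uc pc by (auto simp: continuous_on_def)
  \<comment> \<open>If \<open>V\<close> stayed below \<open>q\<close> near \<open>p\<close>, the
    mean value theorem would make \<open>v\<close> grow along \<open>e\<close> more slowly than
    \<open>growth\<close> allows.\<close>
  have "q \<le> V p"
  proof (rule ccontr)
    assume "\<not> q \<le> V p"
    then have "\<forall>\<^sub>F x in at p within closure \<Omega>. V x < q"
      using order_tendstoD(2)[OF Vt] by simp
    then obtain d where d: "0 < d"
        "\<And>x. x \<in> closure \<Omega> \<Longrightarrow> x \<noteq> p \<Longrightarrow> dist x p < d \<Longrightarrow> V x < q"
      unfolding eventually_at by auto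
    define t where "t = min d (min \<mu> r) / 2"
    have t: "0 < t" "t < d" "t < \<mu>" "t < r"
      using d(1) \<mu> r by (auto simp: t_def min_def)
    obtain z where z: "0 < z" "z < t" "v (p + t *\<^sub>R e) - v p = t * V (p + z *\<^sub>R e)"
      using C1_closure_mvt[OF v V t(1) pc] inside t by (metis order_le_less_trans)
    have "p + z *\<^sub>R e \<in> closure \<Omega>"
      using inside[of z] z t closure_subset by auto
    then have "V (p + z *\<^sub>R e) < q"
      using d(2)[of "p + z *\<^sub>R e"] z t e norm_zero[where 'a="real^'n"] by (fastforce simp: dist_norm)
    then have "t * V (p + z *\<^sub>R e) < q * t"
      using t(1) by (simp add: mult.commute)
    with z growth[OF t(1,3)] zero[OF p] show False
      by simp
  qed
  then have "q / 2 < V p"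
    using q by simp
  with Vt have "\<forall>\<^sub>F x in at p within closure \<Omega>. q / 2 < V x"
    by (rule order_tendstoD(1))
  then obtain d1 where d1: "0 < d1"
      "\<And>x. x \<in> closure \<Omega> \<Longrightarrow> x \<noteq> p \<Longrightarrow> dist x p < d1 \<Longrightarrow> q / 2 < V x"
    unfolding eventually_at by auto
  have "\<forall>\<^sub>F x in at p within closure \<Omega>. U x < \<bar>U p\<bar> + 1"
    by (rule order_tendstoD(2)[OF Ut]) simp
  then obtain d2 where d2: "0 < d2"
      "\<And>x. x \<in> closure \<Omega> \<Longrightarrow> x \<noteq> p \<Longrightarrow> dist x p < d2 \<Longrightarrow> U x < \<bar>U p\<bar> + 1"
    unfolding eventually_at by auto
  \<comment> \<open>Within distance \<open>D\<close> of \<open>p\<close> the graph description and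
    both derivative bounds hold. Distance and height of \<open>x\<close> are each kept below
    \<open>D / 2\<close>, so the whole segment from the boundary up to \<open>x\<close> stays within
    \<open>D\<close>.\<close>
  define D where "D = min r (min d1 d2)"
  have D: "0 < D" "D \<le> r" "D \<le> d1" "D \<le> d2"
    using r d1(1) d2(1) by (auto simp: D_def)
  have "(H \<longlongrightarrow> H p) (at p)"
    using differentiable_imp_continuous_within[OF Hd] by (rule isContD)
  then have "\<forall>\<^sub>F x in at p. H x < D / 2"
    using order_tendstoD(2) Hp D(1) by (metis half_gt_zero)
  then obtain d3 where d3: "0 < d3" "\<And>x. x \<noteq> p \<Longrightarrow> dist x p < d3 \<Longrightarrow> H x < D / 2"
    unfolding eventually_at by auto
  define \<delta> where "\<delta> = min d3 (D / 2)"
  define K where "K = (\<bar>U p\<bar> + 1) / (q / 2)"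
  show thesis
  proof
    show "0 < \<delta>"
      using d3(1) D by (simp add: \<delta>_def)
    show "0 \<le> K"
      using q by (simp add: K_def)
    fix x assume x: "x \<in> \<Omega>" "dist x p < \<delta>"
    have "p \<notin> \<Omega>"
      using p \<open>open \<Omega>\<close> by (simp add: frontier_def interior_open)
    then have "x \<noteq> p"
      using x by blast
    define h where "h = H x"
    have "x \<in> ball p r"
      using x(2) D by (auto simp: \<delta>_def dist_commute)
    then have h: "0 < h" "h < D / 2"
      using near x d3(2)[OF \<open>x \<noteq> p\<close>] by (auto simp: h_def \<delta>_def)
    \<comment> \<open>The foot of \<open>x\<close> on the boundary along \<open>e\<close>: its
      height is \<open>0\<close>, so \<open>u\<close> and \<open>v\<close> vanish there.\<close>
    define f where "f = x - h *\<^sub>R e"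
    have close: "dist (f + s *\<^sub>R e) p < D" if "0 \<le> s" "s \<le> h" for s
    proof -
      have "f + s *\<^sub>R e - p = (x - p) - (h - s) *\<^sub>R e"
        by (simp add: f_def algebra_simps)
      then have "dist (f + s *\<^sub>R e) p \<le> dist x p + norm ((h - s) *\<^sub>R e)"
        unfolding dist_norm by (simp only: norm_triangle_ineq4)
      also have "norm ((h - s) *\<^sub>R e) = h - s"
        using e that by simp
      finally show ?thesis
        using x(2) h that by (simp add: \<delta>_def)
    qed
    have Hf: "H (f + s *\<^sub>R e) = s" for s
      using shift[of x "s - h"] by (simp add: f_def h_def algebra_simps)
    have seg: "f + s *\<^sub>R e \<in> \<Omega>" if "0 < s" "s \<le> h" for s
      using near[of "f + s *\<^sub>R e"] close[of s] D that by (simp add: Hf dist_commute)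
    have "f \<notin> \<Omega>"
      using near[of f] close[of 0] D h Hf[of 0] by (simp add: dist_commute)
    moreover have fc: "f \<in> closure \<Omega>"
    proof (rule Lim_in_closed_set[OF closed_closure])
      show "((\<lambda>s. f + s *\<^sub>R e) \<longlongrightarrow> f) (at_right (0::real))"
        by (auto intro!: tendsto_eq_intros)
      show "\<forall>\<^sub>F s in at_right (0::real). f + s *\<^sub>R e \<in> closure \<Omega>"
        using eventually_at_right_real[OF h(1)]
      proof (rule eventually_mono)
        fix s assume "s \<in> {0<..<h}"
        then show "f + s *\<^sub>R e \<in> closure \<Omega>"
          using seg[of s] closure_subset by auto
      qed
    qed simp
    ultimately have ff: "f \<in> frontier \<Omega>"
      using \<open>open \<Omega>\<close> by (simp add: frontier_def interior_open)
    have fx: "f + h *\<^sub>R e = x"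
      by (simp add: f_def)
    have nh: "f + s *\<^sub>R e \<in> closure \<Omega>" "f + s *\<^sub>R e \<noteq> p" "dist (f + s *\<^sub>R e) p < D"
      if "0 < s" "s < h" for s
      using seg[of s] close[of s] that closure_subset \<open>p \<notin> \<Omega>\<close> by auto
    obtain z1 where z1: "0 < z1" "z1 < h" "u x - u f = h * U (f + z1 *\<^sub>R e)"
      using C1_closure_mvt[OF u U h(1) fc seg] unfolding fx by metis
    obtain z2 where z2: "0 < z2" "z2 < h" "v x - v f = h * V (f + z2 *\<^sub>R e)"
      using C1_closure_mvt[OF v V h(1) fc seg] unfolding fx by metis
    have "U (f + z1 *\<^sub>R e) < \<bar>U p\<bar> + 1"
      using d2(2) nh[OF z1(1,2)] D by simp
    then have "u x \<le> h * (\<bar>U p\<bar> + 1)"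
      using z1 h zero[OF ff] by simp
    also have "\<dots> = K * (h * (q / 2))"
      using q by (simp add: K_def)
    also have "\<dots> \<le> K * v x"
    proof (rule mult_left_mono)
      have "q / 2 < V (f + z2 *\<^sub>R e)"
        using d1(2) nh[OF z2(1,2)] D by simp
      then show "h * (q / 2) \<le> v x"
        using z2 h zero[OF ff] by simp
    qed (use \<open>0 \<le> K\<close> in simp)
    finally show "u x \<le> K * v x" .
  qed
qed

subsection \<open>Nonexistence of coexisting solutions\<close>

text \<open>A maximum of \<open>u\<close> is also one of the quadratic expression, which increases
  for nonnegative arguments; at a value above 1 the reaction term would have the wrong sign. The
  function \<open>w\<close> stands for the competition term, so both equations are covered.\<close>

lemma density_le_one:
  fixes \<Omega> :: "(real^'n::finite) set"
  assumes "open \<Omega>" "bounded \<Omega>" "0 < d" "0 \<le> a"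
    and cont: "continuous_on (closure \<Omega>) u" and diff: "twice_differentiable_on u \<Omega>"
    and nonneg: "\<And>x. x \<in> closure \<Omega> \<Longrightarrow> 0 \<le> u x"
    and zero: "\<And>x. x \<in> frontier \<Omega> \<Longrightarrow> u x = 0"
    and eq: "\<And>x. x \<in> \<Omega> \<Longrightarrow>
      laplacian (\<lambda>y. (d + a * u y) * u y) x + u x * (1 - u x - w x) = 0"
    and w: "\<And>x. x \<in> \<Omega> \<Longrightarrow> 0 \<le> w x"
    and x: "x \<in> closure \<Omega>"
  shows "u x \<le> 1"
proof -
  have "compact (closure \<Omega>)"
    using \<open>bounded \<Omega>\<close> by simp
  moreover have "closure \<Omega> \<noteq> {}"
    using x by auto
  ultimately obtain m where m: "m \<in> closure \<Omega>" "\<And>y. y \<in> closure \<Omega> \<Longrightarrow> u y \<le> u m"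
    using continuous_attains_sup[OF _ _ cont] by blast
  have "u m \<le> 1"
  proof (rule ccontr)
    assume gt: "\<not> u m \<le> 1"
    have "m \<notin> frontier \<Omega>"
      using zero[of m] gt by auto
    then have "m \<in> \<Omega>"
      using m(1) \<open>open \<Omega>\<close> by (simp add: frontier_def interior_open)
    have "laplacian (\<lambda>y. (d + a * u y) * u y) m \<le> 0"
    proof (rule laplacian_nonpos_at_max[OF \<open>open \<Omega>\<close> _ \<open>m \<in> \<Omega>\<close>])
      show "twice_differentiable_on (\<lambda>y. (d + a * u y) * u y) \<Omega>"
        by (rule quadratic_twice_differentiable_on(1)[OF diff \<open>open \<Omega>\<close>])
      fix y assume "y \<in> \<Omega>"
      then have "y \<in> closure \<Omega>"
        using closure_subset by blast
      then have "u y \<le> u m" "0 \<le> u y"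
        using m(2) nonneg by blast+
      moreover from this have "a * u y \<le> a * u m" "0 \<le> a * u y"
        using \<open>0 \<le> a\<close> by (simp_all add: mult_left_mono)
      ultimately show "(d + a * u y) * u y \<le> (d + a * u m) * u m"
        using \<open>0 < d\<close> by (intro mult_mono) auto
    qed
    then have "0 \<le> u m * (1 - u m - w m)"
      using eq[OF \<open>m \<in> \<Omega>\<close>] by linarith
    moreover have "0 < u m" "1 - u m - w m < 0"
      using gt w[OF \<open>m \<in> \<Omega>\<close>] by linarith+
    ultimately show False
      using mult_pos_neg[of "u m" "1 - u m - w m"] by linarith
  qed
  with m(2)[OF x] show ?thesis
    by simp
qed

text \<open>The second derivative, at a critical point, of a function with derivative \<open>P'/u - Q'/v\<close>,
  where \<open>P' = D\<^sub>1 u'\<close> and \<open>Q' = D\<^sub>2 v'\<close>.\<close>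

lemma critical_second_derivative_ineq:
  fixes u v u' v' P' Q' P'' Q'' D\<^sub>1 D\<^sub>2 :: real
  assumes "0 < u" "0 < v" "0 < D\<^sub>2" "D\<^sub>2 \<le> D\<^sub>1" "P' = D\<^sub>1 * u'" "Q' = D\<^sub>2 * v'"
    and crit: "P' / u - Q' / v = 0"
    and le: "(P'' * u - P' * u') / (u * u) - (Q'' * v - Q' * v') / (v * v) \<le> 0"
  shows "P'' / u - Q'' / v \<le> 0"
proof -
  define A where "A = P' / u"
  have A: "A = P' / u" "A = Q' / v"
    using crit by (simp_all add: A_def)
  have u': "P' = A * u"
    unfolding A(1) using assms(1) by simp
  moreover have v': "Q' = A * v"
    unfolding A(2) using assms(2) by simp
  moreover have "u' = P' / D\<^sub>1" "v' = Q' / D\<^sub>2"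
    using assms(3-6) by simp_all
  ultimately have u'': "u' = A * u / D\<^sub>1" and v'': "v' = A * v / D\<^sub>2"
    by simp_all
  \<comment> \<open>The subtracted terms are \<open>A\<^sup>2 / D\<^sub>1\<close> and
    \<open>A\<^sup>2 / D\<^sub>2\<close>; the ordering of the coefficients gives their difference
    the favourable sign.\<close>
  have "P' * u' / (u * u) = A\<^sup>2 / D\<^sub>1"
    unfolding u' u'' using assms(1) by (simp add: power2_eq_square)
  moreover have "Q' * v' / (v * v) = A\<^sup>2 / D\<^sub>2"
    unfolding v' v'' using assms(2) by (simp add: power2_eq_square)
  moreover have "A\<^sup>2 / D\<^sub>1 \<le> A\<^sup>2 / D\<^sub>2"
    using assms by (intro divide_left_mono) auto
  moreover have "(P'' * u - P' * u') / (u * u) = P'' / u - P' * u' / (u * u)"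
    using assms(1) by (simp add: diff_divide_distrib)
  moreover have "(Q'' * v - Q' * v') / (v * v) = Q'' / v - Q' * v' / (v * v)"
    using assms(2) by (simp add: diff_divide_distrib)
  ultimately show ?thesis
    using le by linarith
qed

text \<open>The strict gap between \<open>d\<^sub>2\<close> and \<open>d\<^sub>1\<close> makes
  \<open>F\<close> vanish at the boundary,
  \<open>d\<^sub>2 + 2 * a\<^sub>2\<^sub>2 \<le> d\<^sub>1\<close> with \<open>v \<le> 1\<close>
  orders the diffusion coefficients at the maximum, and the bounds on \<open>a\<^sub>1\<close> and
  \<open>a\<^sub>2\<close> give the final sign.\<close>

lemma no_coexistence:
  fixes \<Omega> :: "(real^'n::finite) set"
  assumes \<Omega>: "open \<Omega>" "connected \<Omega>" "bounded \<Omega>" "smooth_boundary \<Omega>" "interior_ball_condition \<Omega>"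
    and pos: "0 < d\<^sub>1" "0 < d\<^sub>2" "0 \<le> a\<^sub>1\<^sub>1" "0 \<le> a\<^sub>2\<^sub>2" "0 < a\<^sub>2"
    and sol: "nonneg_classical_solution \<Omega> d\<^sub>1 d\<^sub>2 a\<^sub>1 a\<^sub>2 a\<^sub>1\<^sub>1 a\<^sub>2\<^sub>2 u v"
    and cond: "1 < a\<^sub>1" "a\<^sub>2 < 1" "d\<^sub>2 < d\<^sub>1" "d\<^sub>2 + 2 * a\<^sub>2\<^sub>2 \<le> d\<^sub>1"
    and x1: "x1 \<in> \<Omega>" "u x1 \<noteq> 0" and x2: "x2 \<in> \<Omega>" "v x2 \<noteq> 0"
  shows False
proof -
  define P where "P = (\<lambda>y. (d\<^sub>1 + a\<^sub>1\<^sub>1 * u y) * u y)"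
  define Q where "Q = (\<lambda>y. (d\<^sub>2 + a\<^sub>2\<^sub>2 * v y) * v y)"
  have uC: "C1_closure u \<Omega>" and vC: "C1_closure v \<Omega>"
    and "Ck_on 2 u \<Omega>" and "Ck_on 2 v \<Omega>"
    and nonneg: "\<And>x. x \<in> closure \<Omega> \<Longrightarrow> 0 \<le> u x" "\<And>x. x \<in> closure \<Omega> \<Longrightarrow> 0 \<le> v x"
    and eqP: "\<And>x. x \<in> \<Omega> \<Longrightarrow> laplacian P x + u x * (1 - u x - a\<^sub>1 * v x) = 0"
    and eqQ: "\<And>x. x \<in> \<Omega> \<Longrightarrow> laplacian Q x + v x * (1 - a\<^sub>2 * u x - v x) = 0"
    and zero: "\<And>x. x \<in> frontier \<Omega> \<Longrightarrow> u x = 0 \<and> v x = 0"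
    using sol unfolding nonneg_classical_solution_def P_def Q_def by auto
  then have ud: "twice_differentiable_on u \<Omega>" and vd: "twice_differentiable_on v \<Omega>"
    using Ck_on_2_imp_twice_differentiable_on by blast+
  have uc: "continuous_on (closure \<Omega>) u" and vc: "continuous_on (closure \<Omega>) v"
    using uC vC by (auto simp: C1_closure_def)
  have Pd: "twice_differentiable_on P \<Omega>" and Qd: "twice_differentiable_on Q \<Omega>"
    unfolding P_def Q_def by (intro quadratic_twice_differentiable_on(1) ud vd \<Omega>)+
  have Pi: "partial_deriv i P x = (d\<^sub>1 + 2 * a\<^sub>1\<^sub>1 * u x) * partial_deriv i u x"
    and Qi: "partial_deriv i Q x = (d\<^sub>2 + 2 * a\<^sub>2\<^sub>2 * v x) * partial_deriv i v x" if "x \<in> \<Omega>" for x i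
    unfolding P_def Q_def using quadratic_twice_differentiable_on(2) ud vd \<Omega>(1) that by blast+
  have cl: "x \<in> closure \<Omega>" if "x \<in> \<Omega>" for x
    using that closure_subset by blast
  have u1: "u x \<le> 1" if "x \<in> closure \<Omega>" for x
    by (rule density_le_one[OF \<Omega>(1,3) pos(1,3) uc ud nonneg(1) _ eqP[unfolded P_def] _ that])
      (use zero nonneg(2) cl cond in auto)
  have v1: "v x \<le> 1" if "x \<in> closure \<Omega>" for x
  proof (rule density_le_one[OF \<Omega>(1,3) pos(2,4) vc vd nonneg(2) _ _ _ that])
    fix y assume "y \<in> \<Omega>"
    show "laplacian (\<lambda>y. (d\<^sub>2 + a\<^sub>2\<^sub>2 * v y) * v y) y + v y * (1 - v y - a\<^sub>2 * u y) = 0"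
      using eqQ[OF \<open>y \<in> \<Omega>\<close>] by (simp add: Q_def algebra_simps)
  qed (use zero nonneg(1) cl pos in auto)
  have Q0: "0 \<le> Q x" if "x \<in> closure \<Omega>" for x
    using nonneg(2)[OF that] pos by (simp add: Q_def)
  \<comment> \<open>The bounds \<open>u \<le> 1\<close> and \<open>v \<le> 1\<close> turn the
    equation into the differential inequality that the barrier and the minimum principle
    require.\<close>
  have lapQ: "laplacian Q x \<le> (a\<^sub>2 / d\<^sub>2) * Q x" if "x \<in> \<Omega>" for x
  proof -
    note b = u1[OF cl[OF that]] v1[OF cl[OF that]] nonneg(2)[OF cl[OF that]]
    have "laplacian Q x = v x * (a\<^sub>2 * u x + v x - 1)"
      using eqQ[OF that] by (simp add: algebra_simps)
    also have "\<dots> \<le> v x * a\<^sub>2"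
      using b pos(5) mult_left_mono[of "u x" 1 a\<^sub>2] by (intro mult_left_mono) linarith+
    also have "\<dots> = (a\<^sub>2 / d\<^sub>2) * (d\<^sub>2 * v x)"
      using pos by simp
    also have "\<dots> \<le> (a\<^sub>2 / d\<^sub>2) * Q x"
      using b pos unfolding Q_def by (intro mult_left_mono mult_right_mono) auto
    finally show ?thesis .
  qed
  have vpos: "0 < v x" if "x \<in> \<Omega>" for x
  proof -
    have "Q x2 \<noteq> 0"
      using x2 nonneg(2)[OF cl[OF x2(1)]] pos by (simp add: Q_def add_nonneg_eq_0_iff)
    have "0 < Q x"
      by (rule strong_minimum_principle[OF \<Omega>(1,2) _ Qd _ lapQ x2(1) \<open>Q x2 \<noteq> 0\<close> that])
        (use pos Q0 cl in auto)
    then have "v x \<noteq> 0"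
      by (auto simp: Q_def)
    with nonneg(2)[OF cl[OF that]] show ?thesis
      by simp
  qed
  \<comment> \<open>The barrier bounds \<open>Q\<close> from below; as \<open>v \<le> 1\<close>,
    \<open>Q\<close> is at most \<open>(d\<^sub>2 + a\<^sub>2\<^sub>2) * v\<close>, so the bound
    passes to \<open>v\<close>.\<close>
  have hopf: "\<exists>c>0. \<forall>x\<in>ball y R. c * (R - dist x y) \<le> v x" if R: "0 < R" "ball y R \<subseteq> \<Omega>" for y R
  proof -
    have sub: "cball y R \<subseteq> closure \<Omega>"
      using closure_mono[OF R(2)] R(1) by simp
    obtain c where c: "0 < c" "\<And>x. x \<in> ball y R \<Longrightarrow> c * (R - dist x y) \<le> Q x"
    proof (rule exp_barrier_lower_bound[of "R / 2" R "a\<^sub>2 / d\<^sub>2" y Q])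
      show "continuous_on (cball y R) Q"
        unfolding Q_def by (intro continuous_intros continuous_on_subset[OF vc sub])
      show "twice_differentiable_on Q (ball y R)"
        using Qd R(2) by (auto simp: twice_differentiable_on_def)
      fix x assume "x \<in> cball y (R / 2)"
      then have "x \<in> \<Omega>"
        using R by (auto simp: subset_iff)
      then show "0 < Q x"
        using vpos[of x] pos by (simp add: Q_def add_pos_nonneg)
    qed (use R pos Q0 lapQ sub in auto)
    have "c / (d\<^sub>2 + a\<^sub>2\<^sub>2) * (R - dist x y) \<le> v x" if "x \<in> ball y R" for x
    proof -
      have "x \<in> closure \<Omega>"
        using that R(2) cl by blast
      have "Q x \<le> (d\<^sub>2 + a\<^sub>2\<^sub>2) * v x"
        unfolding Q_def using v1[OF \<open>x \<in> closure \<Omega>\<close>] nonneg(2)[OF \<open>x \<in> closure \<Omega>\<close>] pos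
        by (intro mult_right_mono) (auto simp: mult_left_le)
      with c(2)[OF that] have "c * (R - dist x y) \<le> v x * (d\<^sub>2 + a\<^sub>2\<^sub>2)"
        by (simp add: mult.commute)
      then show ?thesis
        using pos by (simp add: pos_divide_le_eq add_pos_nonneg)
    qed
    then show ?thesis
      using c(1) pos by (intro exI[of _ "c / (d\<^sub>2 + a\<^sub>2\<^sub>2)"]) (auto simp: add_pos_nonneg)
  qed

  \<comment> \<open>\<open>F\<close> extends \<open>exp h\<close> by \<open>0\<close>, also to the points with \<open>u x = 0\<close>, since \<open>0 powr d\<^sub>1 = 0\<close>.\<close>
  define F where "F x = (if x \<in> \<Omega>
    then u x powr d\<^sub>1 * exp (2 * a\<^sub>1\<^sub>1 * u x - 2 * a\<^sub>2\<^sub>2 * v x) / v x powr d\<^sub>2 else 0)" for x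
  have F_nonneg: "0 \<le> F x" for x
    by (simp add: F_def)
  have "continuous_on (closure \<Omega>) F"
    unfolding continuous_on_def
  proof
    fix p assume p: "p \<in> closure \<Omega>"
    show "(F \<longlongrightarrow> F p) (at p within closure \<Omega>)"
    proof (cases "p \<in> \<Omega>")
      case True
      have "continuous_on \<Omega> (\<lambda>x. u x powr d\<^sub>1 * exp (2 * a\<^sub>1\<^sub>1 * u x - 2 * a\<^sub>2\<^sub>2 * v x) / v x powr d\<^sub>2)"
        using vpos nonneg(1) cl pos
        by (intro continuous_intros continuous_on_powr' continuous_on_subset[OF uc closure_subset]
            continuous_on_subset[OF vc closure_subset]) (auto simp: less_imp_neq[THEN not_sym] less_imp_le)
      then have "continuous_on \<Omega> F"
        by (rule continuous_on_eq) (simp add: F_def)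
      then have "isCont F p"
        using True \<Omega>(1) by (simp add: continuous_on_eq_continuous_at)
      then show ?thesis
        using isContD tendsto_within_subset by blast
    next
      case False
      then have pf: "p \<in> frontier \<Omega>"
        using p \<Omega>(1) by (simp add: frontier_def interior_open)
      obtain K \<delta> where K: "0 < \<delta>" "0 \<le> K"
          "\<And>x. x \<in> \<Omega> \<Longrightarrow> dist x p < \<delta> \<Longrightarrow> u x \<le> K * v x"
        using boundary_comparison[OF \<Omega>(1,4,5) pf uC vC zero hopf] by metis
      \<comment> \<open>Replacing \<open>u\<close> by \<open>K * v\<close> in the power leaves
        \<open>v\<close> with the positive exponent \<open>d\<^sub>1 - d\<^sub>2\<close>, so this
        majorant tends to \<open>0\<close> at \<open>p\<close>.\<close>
      define B where "B x = exp (2 * a\<^sub>1\<^sub>1 * u x - 2 * a\<^sub>2\<^sub>2 * v x) * K powr d\<^sub>1 * v x powr (d\<^sub>1 - d\<^sub>2)" for x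
      have ut: "(u \<longlongrightarrow> 0) (at p within closure \<Omega>)" and vt: "(v \<longlongrightarrow> 0) (at p within closure \<Omega>)"
        using uc vc p zero[OF pf] by (auto simp: continuous_on_def)
      have "\<forall>\<^sub>F x in at p within closure \<Omega>. x \<in> closure \<Omega>"
        by (simp add: eventually_at_filter)
      then have "((\<lambda>x. v x powr (d\<^sub>1 - d\<^sub>2)) \<longlongrightarrow> 0) (at p within closure \<Omega>)"
        using nonneg(2) cond(3)
        by (intro tendsto_zero_powrI[OF vt tendsto_const]) (auto elim: eventually_mono)
      then have "(B \<longlongrightarrow> exp (2 * a\<^sub>1\<^sub>1 * 0 - 2 * a\<^sub>2\<^sub>2 * 0) * K powr d\<^sub>1 * 0) (at p within closure \<Omega>)"
        unfolding B_def by (intro tendsto_intros ut vt)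
      then have B0: "(B \<longlongrightarrow> 0) (at p within closure \<Omega>)"
        by simp
      have FB: "norm (F x) \<le> B x" if "dist x p < \<delta>" for x
      proof (cases "x \<in> \<Omega>")
        case True
        have "u x powr d\<^sub>1 \<le> (K * v x) powr d\<^sub>1"
          using K(3)[OF True that] nonneg(1)[OF cl[OF True]] pos by (intro powr_mono2) auto
        also have "\<dots> = K powr d\<^sub>1 * v x powr d\<^sub>1"
          using K(2) vpos[OF True] by (simp add: powr_mult)
        finally have "F x \<le> K powr d\<^sub>1 * v x powr d\<^sub>1 * exp (2 * a\<^sub>1\<^sub>1 * u x - 2 * a\<^sub>2\<^sub>2 * v x) / v x powr d\<^sub>2"
          using True by (simp add: F_def divide_right_mono mult_right_mono)
        also have "\<dots> = B x"
          by (simp add: B_def powr_diff)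
        finally show ?thesis
          using F_nonneg by simp
      qed (simp add: F_def B_def)
      have "\<forall>\<^sub>F x in at p within closure \<Omega>. norm (F x) \<le> B x"
        unfolding eventually_at using K(1) FB by blast
      from Lim_null_comparison[OF this B0] have "(F \<longlongrightarrow> 0) (at p within closure \<Omega>)" .
      moreover have "F p = 0"
        using False by (simp add: F_def)
      ultimately show ?thesis
        by simp
    qed
  qed
  moreover have "compact (closure \<Omega>)" "closure \<Omega> \<noteq> {}"
    using \<Omega>(3) x1(1) by auto
  ultimately obtain m where m: "m \<in> closure \<Omega>" "\<And>y. y \<in> closure \<Omega> \<Longrightarrow> F y \<le> F m"
    using continuous_attains_sup[of "closure \<Omega>" F] by blast
  \<comment> \<open>A positive value somewhere forces a positive maximum, so \<open>m\<close> is
    interior and \<open>u\<close> is positive there.\<close>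
  have "0 < F x1"
    using x1 vpos[OF x1(1)] by (simp add: F_def)
  with m(2)[OF cl[OF x1(1)]] have Fm: "F m \<noteq> 0"
    by simp
  then have m\<Omega>: "m \<in> \<Omega>"
    by (auto simp: F_def split: if_splits)
  with Fm nonneg(1)[OF m(1)] have um: "0 < u m"
    by (cases "u m = 0") (auto simp: F_def)
  \<comment> \<open>An open neighbourhood of \<open>m\<close> on which both logarithms in
    \<open>h\<close> are differentiable.\<close>
  define S where "S = \<Omega> \<inter> u -` {0<..}"
  have "open S"
    unfolding S_def
    using continuous_open_preimage[OF continuous_on_subset[OF uc closure_subset] \<Omega>(1)] by simp
  have mS: "m \<in> S"
    using m\<Omega> um by (simp add: S_def)
  define h where "h x = d\<^sub>1 * ln (u x) + 2 * a\<^sub>1\<^sub>1 * u x - d\<^sub>2 * ln (v x) - 2 * a\<^sub>2\<^sub>2 * v x" for x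
  have Fh: "F x = exp (h x)" if "x \<in> S" for x
    using that vpos[of x]
    by (auto simp: F_def h_def S_def powr_def exp_add exp_diff field_simps)
  have hmax: "h x \<le> h m" if "x \<in> S" for x
  proof -
    have "F x \<le> F m"
      using m(2)[OF cl] that by (simp add: S_def)
    then show ?thesis
      by (simp add: Fh[OF that] Fh[OF mS])
  qed
  \<comment> \<open>The test is run on each coordinate line separately, so the common quotient of
    the critical point condition is a scalar, the \<open>i\<close>-th component of the vector
    \<nabla>P/u.\<close>
  have "partial_deriv i (partial_deriv i P) m / u m - partial_deriv i (partial_deriv i Q) m / v m \<le> 0" for i
  proof -
    define z where "z t = m + t *\<^sub>R axis i 1" for t :: real
    obtain \<eta> where \<eta>: "0 < \<eta>" "\<And>t. \<bar>t\<bar> < \<eta> \<Longrightarrow> z t \<in> S"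
      unfolding z_def using open_line_nhd[OF \<open>open S\<close> mS] by blast
    have z0: "z 0 = m"
      by (simp add: z_def)
    have z\<Omega>: "z t \<in> \<Omega>" "0 < u (z t)" "0 < v (z t)" if "\<bar>t\<bar> < \<eta>" for t
      using \<eta>(2)[OF that] vpos by (auto simp: S_def)
    have du: "((\<lambda>t. u (z t)) has_real_derivative partial_deriv i u (z t)) (at t)"
      and dv: "((\<lambda>t. v (z t)) has_real_derivative partial_deriv i v (z t)) (at t)"
      if "\<bar>t\<bar> < \<eta>" for t
      using line_derivatives(1) ud vd z\<Omega>(1)[OF that] unfolding z_def by blast+
    have dP: "((\<lambda>t. partial_deriv i P (z t)) has_real_derivative
        partial_deriv i (partial_deriv i P) (z 0)) (at 0)"
      and dQ: "((\<lambda>t. partial_deriv i Q (z t)) has_real_derivative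
        partial_deriv i (partial_deriv i Q) (z 0)) (at 0)"
      using line_derivatives(2) Pd Qd z\<Omega>(1)[of 0] \<eta>(1) unfolding z_def by fastforce+
    let ?h' = "\<lambda>t. partial_deriv i P (z t) / u (z t) - partial_deriv i Q (z t) / v (z t)"
    let ?h'' = "(partial_deriv i (partial_deriv i P) (z 0) * u (z 0) - partial_deriv i P (z 0) * partial_deriv i u (z 0))
        / (u (z 0) * u (z 0))
      - (partial_deriv i (partial_deriv i Q) (z 0) * v (z 0) - partial_deriv i Q (z 0) * partial_deriv i v (z 0))
        / (v (z 0) * v (z 0))"
    have h': "((\<lambda>t. h (z t)) has_real_derivative ?h' t) (at t)" if t: "\<bar>t\<bar> < \<eta>" for t
    proof -
      note ln' = DERIV_chain2[OF DERIV_ln]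
      have "((\<lambda>t. h (z t)) has_real_derivative
          d\<^sub>1 * (inverse (u (z t)) * partial_deriv i u (z t)) + 2 * a\<^sub>1\<^sub>1 * partial_deriv i u (z t)
          - d\<^sub>2 * (inverse (v (z t)) * partial_deriv i v (z t)) - 2 * a\<^sub>2\<^sub>2 * partial_deriv i v (z t)) (at t)"
        unfolding h_def using z\<Omega>[OF t]
        by (intro DERIV_diff DERIV_add DERIV_cmult ln' du[OF t] dv[OF t])
      then show ?thesis
        by (rule DERIV_cong) (use z\<Omega>[OF t] in \<open>simp add: Pi Qi field_simps\<close>)
    qed
    have h'': "(?h' has_real_derivative ?h'') (at 0)"
      using z\<Omega>[of 0] \<eta>(1) by (intro DERIV_diff DERIV_divide dP dQ du dv) auto
    have "h (z t) \<le> h (z 0)" if "\<bar>t\<bar> < \<eta>" for t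
      using hmax[OF \<eta>(2)[OF that]] by (simp add: z0)
    from second_derivative_test_max[OF \<eta>(1) h' h'' this]
    have crit: "?h' 0 = 0" and le: "?h'' \<le> 0"
      by blast+
    show ?thesis
    proof (rule critical_second_derivative_ineq[OF um vpos[OF m\<Omega>] _ _ Pi[OF m\<Omega>] Qi[OF m\<Omega>]
          crit[unfolded z0] le[unfolded z0]])
      show "0 < d\<^sub>2 + 2 * a\<^sub>2\<^sub>2 * v m"
        using pos vpos[OF m\<Omega>] by (simp add: add_pos_nonneg)
      have "2 * a\<^sub>2\<^sub>2 * v m \<le> 2 * a\<^sub>2\<^sub>2"
        using v1[OF m(1)] pos by (simp add: mult_left_le)
      moreover have "0 \<le> 2 * a\<^sub>1\<^sub>1 * u m"
        using um pos by simp
      ultimately show "d\<^sub>2 + 2 * a\<^sub>2\<^sub>2 * v m \<le> d\<^sub>1 + 2 * a\<^sub>1\<^sub>1 * u m"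
        using cond(4) by linarith
    qed
  qed
  then have "laplacian P m / u m - laplacian Q m / v m \<le> 0"
    unfolding laplacian_def sum_divide_distrib sum_subtractf[symmetric] by (intro sum_nonpos)
  moreover have "laplacian P m / u m = - (1 - u m - a\<^sub>1 * v m)"
  proof -
    have "laplacian P m = - (1 - u m - a\<^sub>1 * v m) * u m"
      using eqP[OF m\<Omega>] by (simp add: algebra_simps)
    then show ?thesis
      using um by (simp only: nonzero_mult_div_cancel_right less_imp_neq[THEN not_sym] not_False_eq_True)
  qed
  moreover have "laplacian Q m / v m = - (1 - a\<^sub>2 * u m - v m)"
  proof -
    have "laplacian Q m = - (1 - a\<^sub>2 * u m - v m) * v m"
      using eqQ[OF m\<Omega>] by (simp add: algebra_simps)
    then show ?thesis
      using vpos[OF m\<Omega>] by (simp only: nonzero_mult_div_cancel_right less_imp_neq[THEN not_sym] not_False_eq_True)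
  qed
  \<comment> \<open>Dividing the equations by \<open>u m\<close> and \<open>v m\<close> leaves the
    two growth rates, whose constant terms cancel.\<close>
  ultimately have "(1 - a\<^sub>2) * u m + (a\<^sub>1 - 1) * v m \<le> 0"
    by (simp add: algebra_simps)
  moreover have "0 < (1 - a\<^sub>2) * u m" "0 < (a\<^sub>1 - 1) * v m"
    using um vpos[OF m\<Omega>] cond by simp_all
  ultimately show False
    by linarith
qed

text \<open>Exchanging the two species turns alternative (ii) into alternative (i).\<close>

lemma nonneg_classical_solution_swap:
  assumes "nonneg_classical_solution \<Omega> d\<^sub>1 d\<^sub>2 a\<^sub>1 a\<^sub>2 a\<^sub>1\<^sub>1 a\<^sub>2\<^sub>2 u v"
  shows "nonneg_classical_solution \<Omega> d\<^sub>2 d\<^sub>1 a\<^sub>2 a\<^sub>1 a\<^sub>2\<^sub>2 a\<^sub>1\<^sub>1 v u"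
proof -
  have "1 - u x - a\<^sub>1 * v x = 1 - a\<^sub>1 * v x - u x" "1 - a\<^sub>2 * u x - v x = 1 - v x - a\<^sub>2 * u x" for x
    by simp_all
  note eq = this
  show ?thesis
    using assms unfolding nonneg_classical_solution_def eq by blast
qed

theorem theorem3p2:
  fixes \<Omega> :: "(real^'n::finite) set"
    and d\<^sub>1 d\<^sub>2 a\<^sub>1 a\<^sub>2 a\<^sub>1\<^sub>1 a\<^sub>2\<^sub>2 :: real
    and u v :: "real^'n \<Rightarrow> real"
  assumes "open \<Omega>" and "connected \<Omega>" and "\<Omega> \<noteq> {}" and "bounded \<Omega>"
    and "smooth_boundary \<Omega>" and "interior_ball_condition \<Omega>"
    and "0 < a\<^sub>1" and "0 < a\<^sub>2" and "0 < d\<^sub>1" and "0 < d\<^sub>2"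
    and "0 \<le> a\<^sub>1\<^sub>1" and "0 \<le> a\<^sub>2\<^sub>2"
    and "nonneg_classical_solution \<Omega> d\<^sub>1 d\<^sub>2 a\<^sub>1 a\<^sub>2 a\<^sub>1\<^sub>1 a\<^sub>2\<^sub>2 u v"
    and "(a\<^sub>1 > 1 \<and> 1 > a\<^sub>2 \<and> d\<^sub>1 > d\<^sub>2 \<and> d\<^sub>1 \<ge> d\<^sub>2 + 2 * a\<^sub>2\<^sub>2) \<or>
         (a\<^sub>1 < 1 \<and> 1 < a\<^sub>2 \<and> d\<^sub>1 < d\<^sub>2 \<and> d\<^sub>2 \<ge> d\<^sub>1 + 2 * a\<^sub>1\<^sub>1)"
  shows "\<not> coexisting_solution \<Omega> d\<^sub>1 d\<^sub>2 a\<^sub>1 a\<^sub>2 a\<^sub>1\<^sub>1 a\<^sub>2\<^sub>2 u v \<and>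
         ((\<forall>x\<in>\<Omega>. u x = 0) \<or> (\<forall>x\<in>\<Omega>. v x = 0))"
proof -
  \<comment> \<open>The points where \<open>u\<close> and \<open>v\<close> are nonzero may differ;
    refuting every such pair gives both conclusions at once.\<close>
  have "False" if "x1 \<in> \<Omega>" "u x1 \<noteq> 0" "x2 \<in> \<Omega>" "v x2 \<noteq> 0" for x1 x2
    using assms(14)
  proof (elim disjE conjE)
    assume "1 < a\<^sub>1" "a\<^sub>2 < 1" "d\<^sub>2 < d\<^sub>1" "d\<^sub>2 + 2 * a\<^sub>2\<^sub>2 \<le> d\<^sub>1"
    then show False
      by (rule no_coexistence[OF assms(1,2,4-6,9-12,8,13) _ _ _ _ that])
  next
    assume "a\<^sub>1 < 1" "1 < a\<^sub>2" "d\<^sub>1 < d\<^sub>2" "d\<^sub>1 + 2 * a\<^sub>1\<^sub>1 \<le> d\<^sub>2"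
    then show False
      by (intro no_coexistence[OF assms(1,2,4-6,10,9,12,11,7) nonneg_classical_solution_swap[OF assms(13)]
          _ _ _ _ that(3,4,1,2)])
  qed
  then show ?thesis
    unfolding coexisting_solution_def by blast
qed

end
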